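(* Let $n\ge1$ and $w\ge1$. There is a bijection between step polyominoes of width $w$ and height $n+1$ and Young diagrams (of partitions) which fit inside the staircase shape $(n-1,n-2,\ldots,1)$ and have exactly $w-1$ corners.
   Context: A parallelogram polyomino is a finite union of unit cells of the plane bounded by two lattice paths that start at the origin, use only unit steps north $[0,1]$ and east $[1,0]$, end at a common point, and meet only at their start and end points; its width and height are the coordinates of the common end point. A step polyomino is a parallelogram polyomino in which every horizontal boundary segment has length $1$, i.e. neither boundary path contains two consecutive east steps. A Young diagram fits inside $(n-1,n-2,\ldots,1)$ if its partition $\Lambda$ satisfies $\Lambda_i\le n-i$ for all $i$; its corners are the cells $(i,\Lambda_i)$ with $\Lambda_i>\Lambda_{i+1}$ (equivalently, their number is the number of distinct nonzero parts of $\Lambda$). *)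

theory Defs imports Main begin

datatype lattice_step = North | East

text \<open>A lattice path is the list of its steps; it starts at the origin.\<close>

type_synonym lattice_path = "lattice_step list"

definition path_vertex :: "lattice_path \<Rightarrow> nat \<Rightarrow> nat \<times> nat" where
  "path_vertex p k = (count_list (take k p) East, count_list (take k p) North)"

definition path_vertices :: "lattice_path \<Rightarrow> (nat \<times> nat) set" where
  "path_vertices p = path_vertex p ` {0..length p}"

definition path_end :: "lattice_path \<Rightarrow> nat \<times> nat" where
  "path_end p = path_vertex p (length p)"

text \<open>The left end points of the unit horizontal edges of a path.\<close>

definition east_edges :: "lattice_path \<Rightarrow> (nat \<times> nat) set" where
  "east_edges p = {path_vertex p k | k. k < length p \<and> p ! k = East}"

text \<open>
  The conditions on the first steps say which of the two paths is the upper one and exclude the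
  degenerate case of two copies of the same one-step path, which bound no cell.
  Lattice paths meet in a point or a common edge only if they share a vertex or the two end points
  of that edge, so it suffices to consider vertices.
\<close>

definition bounding_paths :: "nat \<Rightarrow> nat \<Rightarrow> lattice_path \<Rightarrow> lattice_path \<Rightarrow> bool" where
  "bounding_paths w h U L \<longleftrightarrow>
     U \<noteq> [] \<and> hd U = North \<and> L \<noteq> [] \<and> hd L = East \<and>
     path_end U = (w, h) \<and> path_end L = (w, h) \<and>
     path_vertices U \<inter> path_vertices L = {(0, 0), (w, h)}"

text \<open>
  A unit cell is represented by its lower left corner: \<open>(x, y)\<close> stands for the square
  \<open>[x, x + 1] \<times> [y, y + 1]\<close>. It lies between the paths if it is above the horizontal edge of
  the lower path and below the horizontal edge of the upper path in its column.
\<close>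

definition cells_between :: "lattice_path \<Rightarrow> lattice_path \<Rightarrow> (nat \<times> nat) set" where
  "cells_between U L =
     {(x, y). \<exists>a b. (x, a) \<in> east_edges L \<and> (x, b) \<in> east_edges U \<and> a \<le> y \<and> y < b}"

definition no_consecutive_east :: "lattice_path \<Rightarrow> bool" where
  "no_consecutive_east p \<longleftrightarrow>
     (\<forall>k. Suc k < length p \<longrightarrow> \<not> (p ! k = East \<and> p ! Suc k = East))"

text \<open>
  The first two conjuncts say that \<open>P\<close> is the parallelogram polyomino of width \<open>w\<close> and height
  \<open>h\<close> bounded by \<open>U\<close> and \<open>L\<close>.
\<close>

definition step_polyomino :: "nat \<Rightarrow> nat \<Rightarrow> (nat \<times> nat) set \<Rightarrow> bool" where
  "step_polyomino w h P \<longleftrightarrow>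
     (\<exists>U L. bounding_paths w h U L \<and> P = cells_between U L \<and>
        no_consecutive_east U \<and> no_consecutive_east L)"

text \<open>A partition is the weakly decreasing list of its nonzero parts.\<close>

definition int_partition :: "nat list \<Rightarrow> bool" where
  "int_partition \<Lambda> \<longleftrightarrow> sorted_wrt (\<ge>) \<Lambda> \<and> (\<forall>x \<in> set \<Lambda>. 0 < x)"

text \<open>Parts are indexed from 1 and are 0 beyond the length (index 0 is never used).\<close>

definition partition_part :: "nat list \<Rightarrow> nat \<Rightarrow> nat" where
  "partition_part \<Lambda> i = (if 1 \<le> i \<and> i \<le> length \<Lambda> then \<Lambda> ! (i - 1) else 0)"

definition young_diagram :: "nat list \<Rightarrow> (nat \<times> nat) set" where
  "young_diagram \<Lambda> = {(i, j). 1 \<le> i \<and> 1 \<le> j \<and> j \<le> partition_part \<Lambda> i}"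

text \<open>
  The subtraction truncates: for \<open>i \<ge> n\<close> the condition says that the \<open>i\<close>-th part is 0,
  as the staircase has only \<open>n - 1\<close> rows.
\<close>

definition fits_in_staircase :: "nat \<Rightarrow> nat list \<Rightarrow> bool" where
  "fits_in_staircase n \<Lambda> \<longleftrightarrow> (\<forall>i \<ge> 1. partition_part \<Lambda> i \<le> n - i)"

definition diagram_corners :: "nat list \<Rightarrow> (nat \<times> nat) set" where
  "diagram_corners \<Lambda> =
     {(i, partition_part \<Lambda> i) | i. 1 \<le> i \<and> partition_part \<Lambda> i > partition_part \<Lambda> (i + 1)}"

end

theory Submission imports Defs begin

text \<open>
  A path without consecutive east steps has at most one east step at each height, so it is
  determined by the set of these heights. Let \<open>A\<close> and \<open>B\<close> be the sets of heights of the lower and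
  the upper path, with increasing enumerations \<open>0 = a\<^sub>0 < \<dots> < a\<^bsub>w-1\<^esub>\<close> and
  \<open>b\<^sub>0 < \<dots> < b\<^bsub>w-1\<^esub> = n + 1\<close>. The paths meet only at their ends iff \<open>a\<^bsub>i+1\<^esub> < b\<^sub>i\<close> for all \<open>i\<close>, that is,
  iff for \<open>1 \<le> y \<le> n\<close> the number of elements of \<open>B\<close> up to \<open>y\<close> is smaller than the number of elements
  of \<open>A\<close> below \<open>y\<close>. A Young diagram with \<open>w - 1\<close> corners is given by the rows \<open>i\<^sub>1 < \<dots> < i\<^bsub>w-1\<^esub>\<close> and
  the columns \<open>j\<^sub>1 > \<dots> > j\<^bsub>w-1\<^esub>\<close> of its corners, and it fits inside the staircase iff
  \<open>i\<^sub>m + j\<^sub>m \<le> n\<close> for all \<open>m\<close>. With \<open>a\<^sub>m = i\<^sub>m\<close> and \<open>b\<^bsub>m-1\<^esub> = n + 1 - j\<^sub>m\<close> the two conditions agree.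
\<close>

section \<open>Counting the elements of a set of heights\<close>

text \<open>For \<open>y\<close> in \<open>H\<close> this is the index of \<open>y\<close>, counted
  from 0, in the increasing enumeration of \<open>H\<close>. It is also the abscissa at which the
  path with east steps at the heights \<open>H\<close> reaches height \<open>y\<close>.\<close>

definition rank :: "nat set \<Rightarrow> nat \<Rightarrow> nat" where
  "rank H y = card (H \<inter> {..<y})"

lemma rank_0 [simp]: "rank H 0 = 0"
  by (simp add: rank_def)

lemma rank_Suc: "rank H (Suc y) = rank H y + (if y \<in> H then 1 else 0)"
proof -
  have "H \<inter> {..<Suc y} = (if y \<in> H then insert y (H \<inter> {..<y}) else H \<inter> {..<y})"
    by (auto simp: less_Suc_eq)
  then show ?thesis by (simp add: rank_def)
qed

lemma rank_mono: "x \<le> y \<Longrightarrow> rank H x \<le> rank H y"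
  unfolding rank_def by (intro card_mono) auto

lemma rank_strict_mono: "x \<in> H \<Longrightarrow> x < y \<Longrightarrow> rank H x < rank H y"
  using rank_mono[of "Suc x" y H] by (simp add: rank_Suc)

lemma rank_eq_card: "H \<subseteq> {..<y} \<Longrightarrow> rank H y = card H"
  by (simp add: rank_def Int_absorb2)

lemma rank_le_card: "finite H \<Longrightarrow> rank H y \<le> card H"
  unfolding rank_def by (intro card_mono) auto

text \<open>The rank starts at 0 and grows by at most one per step, so it skips no value, and it
  leaves the value \<open>x\<close> exactly at an element of \<open>H\<close>.\<close>

lemma ex_rank_eq:
  assumes "x < rank H y"
  shows "\<exists>a\<in>H. a < y \<and> rank H a = x"
  using assms
proof (induction y)
  case (Suc y)
  show ?case
  proof (cases "x < rank H y")
    case True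
    then show ?thesis using Suc.IH less_SucI by blast
  next
    case False
    then show ?thesis using Suc.prems by (auto simp: rank_Suc split: if_splits)
  qed
qed simp

lemma ex_rank_eq_iff: "(\<exists>a\<in>H. a \<le> y \<and> rank H a = x) \<longleftrightarrow> x < rank H (Suc y)"
  using ex_rank_eq[of x H "Suc y"] rank_strict_mono[of _ H "Suc y"] by (auto simp: less_Suc_eq_le)

lemma ex_rank_eq_greater_iff:
  assumes "finite H"
  shows "(\<exists>b\<in>H. y < b \<and> rank H b = x) \<longleftrightarrow> rank H (Suc y) \<le> x \<and> x < card H"
proof -
  obtain m where m: "H \<subseteq> {..<m}" using assms by (auto simp: finite_nat_set_iff_bounded)
  show ?thesis
  proof
    assume "\<exists>b\<in>H. y < b \<and> rank H b = x"
    then obtain b where "b \<in> H" "y < b" "rank H b = x" by auto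
    moreover have "rank H b < rank H (Suc b)" using \<open>b \<in> H\<close> by (simp add: rank_Suc)
    ultimately show "rank H (Suc y) \<le> x \<and> x < card H"
      using rank_mono[of "Suc y" b H] rank_le_card[OF assms, of "Suc b"] by auto
  next
    assume *: "rank H (Suc y) \<le> x \<and> x < card H"
    then obtain b where b: "b \<in> H" "rank H b = x"
      using ex_rank_eq[of x H m] rank_eq_card[OF m] by auto
    have "y < b"
      using rank_strict_mono[of b H "Suc y"] b * by (cases "y < b") auto
    then show "\<exists>b\<in>H. y < b \<and> rank H b = x" using b by auto
  qed
qed

section \<open>Lattice paths encoded by the heights of their east steps\<close>

fun stair :: "nat set \<Rightarrow> nat \<Rightarrow> lattice_path" where
  "stair H 0 = (if 0 \<in> H then [East] else [])"
| "stair H (Suc m) = stair H m @ North # (if Suc m \<in> H then [East] else [])"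

lemma stair_cong: "(\<And>y. y \<le> h \<Longrightarrow> y \<in> H \<longleftrightarrow> y \<in> H') \<Longrightarrow> stair H h = stair H' h"
  by (induction h) auto

lemma no_consecutive_east_snoc_North:
  "no_consecutive_east (p @ [North]) \<longleftrightarrow> no_consecutive_east p"
  by (auto simp: no_consecutive_east_def nth_append less_Suc_eq)

lemma no_consecutive_east_snoc_East:
  "no_consecutive_east (p @ [East]) \<longleftrightarrow> no_consecutive_east p \<and> (p = [] \<or> last p = North)"
proof (cases p rule: rev_cases)
  case (snoc q s)
  show ?thesis unfolding snoc
    by (cases s) (auto simp: no_consecutive_east_def nth_append less_Suc_eq)
qed (simp add: no_consecutive_east_def)

lemma no_consecutive_east_stair: "no_consecutive_east (stair H h)"
proof (induction h)
  case 0
  show ?case by (simp add: no_consecutive_east_def)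
next
  case (Suc h)
  then show ?case
    using no_consecutive_east_snoc_East[of "stair H h @ [North]"]
    by (auto simp: no_consecutive_east_snoc_North)
qed

text \<open>The path is built step by step: a north step keeps \<open>H\<close>, an east step
  inserts the current height. The bound on \<open>H\<close> keeps heights not yet reached out of the
  set, so that a north step creates no spurious east step.\<close>

lemma ex_stair:
  assumes "no_consecutive_east p"
  shows "\<exists>H \<subseteq> {..count_list p North}. p = stair H (count_list p North)"
  using assms
proof (induction p rule: rev_induct)
  case Nil
  show ?case by (intro exI[of _ "{}"]) auto
next
  case (snoc s p)
  show ?case
  proof (cases s)
    case North
    then obtain H where H: "H \<subseteq> {..count_list p North}" "p = stair H (count_list p North)"
      using snoc no_consecutive_east_snoc_North by auto
    then have "Suc (count_list p North) \<notin> H" by auto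
    then show ?thesis using H North by (intro exI[of _ H]) auto
  next
    case East
    let ?h = "count_list p North"
    obtain H where H: "H \<subseteq> {..?h}" "p = stair H ?h" and last: "p = [] \<or> last p = North"
      using snoc East no_consecutive_east_snoc_East by auto
    \<comment> \<open>Otherwise the path so far would end in an east step, and the appended one
      would be consecutive to it.\<close>
    have "?h \<notin> H"
    proof
      assume "?h \<in> H"
      then have "stair H ?h \<noteq> [] \<and> last (stair H ?h) = East" by (cases ?h) auto
      then show False using last H(2) by auto
    qed
    moreover have "stair (insert k H) k = stair H k @ [East]" if "k \<notin> H" for k
      using that by (cases k) (auto intro: stair_cong)
    ultimately have "stair (insert ?h H) ?h = p @ [East]" using H(2) by metis
    then show ?thesis using H(1) East by (intro exI[of _ "insert ?h H"]) auto
  qed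
qed

lemma path_end_eq: "path_end p = (count_list p East, count_list p North)"
  by (simp add: path_end_def path_vertex_def)

lemma path_vertices_Nil: "path_vertices [] = {(0, 0)}"
  by (simp add: path_vertices_def path_vertex_def)

lemma path_vertices_snoc: "path_vertices (p @ [s]) = insert (path_end (p @ [s])) (path_vertices p)"
proof -
  have "{0..length (p @ [s])} = insert (length (p @ [s])) {0..length p}" by auto
  moreover have "path_vertex (p @ [s]) k = path_vertex p k" if "k \<in> {0..length p}" for k
    using that by (simp add: path_vertex_def)
  ultimately show ?thesis
    unfolding path_vertices_def path_end_def by (metis (no_types, lifting) image_cong image_insert)
qed

lemma east_edges_Nil: "east_edges [] = {}"
  by (simp add: east_edges_def)

lemma east_edges_snoc:
  "east_edges (p @ [s]) = (if s = East then insert (path_end p) (east_edges p) else east_edges p)"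
proof -
  have image: "east_edges q = path_vertex q ` {k. k < length q \<and> q ! k = East}" for q
    by (auto simp: east_edges_def)
  let ?S = "{k. k < length p \<and> p ! k = East}"
  have "{k. k < length (p @ [s]) \<and> (p @ [s]) ! k = East} =
      (if s = East then insert (length p) ?S else ?S)"
    by (auto simp: nth_append less_Suc_eq)
  moreover have "path_vertex (p @ [s]) k = path_vertex p k" if "k \<le> length p" for k
    using that by (simp add: path_vertex_def)
  then have "path_vertex (p @ [s]) ` ?S = path_vertex p ` ?S"
    "path_vertex (p @ [s]) (length p) = path_end p"
    by (auto simp: path_end_def intro!: image_cong)
  ultimately show ?thesis by (cases s) (simp_all add: image)
qed

lemma count_East_stair: "count_list (stair H h) East = rank H (Suc h)"
  by (induction h) (auto simp: rank_Suc)

lemma count_North_stair: "count_list (stair H h) North = h"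
  by (induction h) auto

lemmas path_end_stair = path_end_eq count_East_stair count_North_stair

lemma stair_Suc:
  "stair H (Suc h) = (if Suc h \<in> H then (stair H h @ [North]) @ [East] else stair H h @ [North])"
  by simp

lemma stair_0: "stair H 0 = (if 0 \<in> H then [] @ [East] else [])"
  by simp

text \<open>The path enters height \<open>y\<close> after \<open>rank H y\<close> east steps and
  leaves it after \<open>rank H (Suc y)\<close>; these abscissas are equal or adjacent, so nothing
  lies between them.\<close>

lemma path_vertices_stair:
  "path_vertices (stair H h) = {(x, y). y \<le> h \<and> rank H y \<le> x \<and> x \<le> rank H (Suc y)}"
proof (induction h)
  case 0
  show ?case
    unfolding stair_0 by (cases "0 \<in> H")
      (auto simp: path_vertices_snoc path_vertices_Nil path_end_eq rank_Suc simp del: append_Nil)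
next
  case (Suc h)
  have "path_vertices (stair H (Suc h)) =
      {(rank H (Suc h), Suc h), (rank H (Suc (Suc h)), Suc h)} \<union> path_vertices (stair H h)"
    unfolding stair_Suc
    by (cases "Suc h \<in> H")
      (simp_all add: path_vertices_snoc path_end_stair rank_Suc[of H "Suc h"] insert_commute
        del: append_assoc)
  moreover have "{x. rank H (Suc h) \<le> x \<and> x \<le> rank H (Suc (Suc h))} =
      {rank H (Suc h), rank H (Suc (Suc h))}"
    by (auto simp: rank_Suc[of H "Suc h"])
  ultimately show ?case unfolding Suc by (auto simp: le_Suc_eq)
qed

lemma east_edges_stair:
  "east_edges (stair H h) = {(x, y). y \<le> h \<and> y \<in> H \<and> x = rank H y}"
proof (induction h)
  case 0
  show ?case
    unfolding stair_0 by (cases "0 \<in> H")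
      (auto simp: east_edges_snoc east_edges_Nil path_end_eq simp del: append_Nil)
next
  case (Suc h)
  have "east_edges (stair H (Suc h)) =
      (if Suc h \<in> H then {(rank H (Suc h), Suc h)} else {}) \<union> east_edges (stair H h)"
    unfolding stair_Suc
    by (simp add: east_edges_snoc path_end_stair del: append_assoc)
  then show ?case unfolding Suc by (auto simp: le_Suc_eq)
qed

lemma stair_hd_East: "stair H h \<noteq> [] \<and> hd (stair H h) = East \<longleftrightarrow> 0 \<in> H"
proof (induction h)
  case (Suc h)
  then show ?case by (cases "stair H h") auto
qed simp

lemma stair_hd_North: "stair H (Suc h) \<noteq> [] \<and> hd (stair H (Suc h)) = North \<longleftrightarrow> 0 \<notin> H"
proof -
  have "stair H (Suc h) \<noteq> []" by simp
  then show ?thesis using stair_hd_East[of H "Suc h"] by (metis lattice_step.distinct(1) lattice_step.exhaust)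
qed

section \<open>Polyominoes as admissible pairs of height sets\<close>

text \<open>The last conjunct is separation at the inner heights: the upper path leaves height
  \<open>y\<close> strictly to the left of the point where the lower path enters it.\<close>

definition admissible :: "nat \<Rightarrow> nat \<Rightarrow> nat set \<Rightarrow> nat set \<Rightarrow> bool" where
  "admissible n w A B \<longleftrightarrow>
     A \<subseteq> {..n} \<and> 0 \<in> A \<and> B \<subseteq> {1..Suc n} \<and> Suc n \<in> B \<and> card A = w \<and> card B = w \<and>
     (\<forall>y\<in>{1..n}. rank B (Suc y) < rank A y)"

lemma bounding_paths_stair:
  assumes "A \<subseteq> {..Suc n}" "B \<subseteq> {..Suc n}"
  shows "bounding_paths w (Suc n) (stair B (Suc n)) (stair A (Suc n)) \<longleftrightarrow> admissible n w A B"
    (is "?b \<longleftrightarrow> _")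
proof -
  have full: "rank A (Suc (Suc n)) = card A" "rank B (Suc (Suc n)) = card B"
    using assms by (auto intro!: rank_eq_card)
  have b: "?b \<longleftrightarrow> 0 \<notin> B \<and> 0 \<in> A \<and> card A = w \<and> card B = w \<and>
     (\<forall>x y. y \<le> Suc n \<and> rank B y \<le> x \<and> x \<le> rank B (Suc y) \<and> rank A y \<le> x \<and> x \<le> rank A (Suc y)
        \<longleftrightarrow> (x, y) = (0, 0) \<or> (x, y) = (w, Suc n))" (is "_ \<longleftrightarrow> ?c")
    unfolding bounding_paths_def path_vertices_stair
    using stair_hd_North[of B n] stair_hd_East[of A "Suc n"]
    by (auto simp: path_end_stair full set_eq_iff simp del: stair.simps)
  show ?thesis
  proof
    assume ?b
    then have c: "0 \<notin> B" "0 \<in> A" "card A = w" "card B = w"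
      and meet: "\<And>x y. \<lbrakk>y \<le> Suc n; rank B y \<le> x; x \<le> rank B (Suc y); rank A y \<le> x;
         x \<le> rank A (Suc y)\<rbrakk> \<Longrightarrow> (x, y) = (0, 0) \<or> (x, y) = (w, Suc n)"
      using b by blast+
    \<comment> \<open>If the upper path enters an inner height strictly to the left of the lower
      one, its single possible east step can at most bring it to the entry point of the lower path.
      That would be a forbidden common vertex.\<close>
    have step: "rank B (Suc (Suc y)) < rank A (Suc y)"
      if "rank B (Suc y) < rank A (Suc y)" "Suc y \<le> n" for y
    proof (rule ccontr)
      assume "\<not> ?thesis"
      then have "rank B (Suc (Suc y)) = rank A (Suc y)"
        using that by (auto simp: rank_Suc[of B "Suc y"] split: if_splits)
      then show False
        using meet[of "Suc y" "rank A (Suc y)"] that rank_mono[of "Suc y" "Suc (Suc y)"] by auto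
    qed
    have less: "rank B (Suc y) < rank A (Suc y)" if "y \<le> n" for y
      using that
    proof (induction y)
      case 0
      show ?case using c by (simp add: rank_Suc)
    next
      case (Suc y)
      then show ?case using step[of y] rank_mono[of "Suc y" "Suc (Suc y)" A] by auto
    qed
    have sep: "rank B (Suc y) < rank A y" if "y \<in> {1..n}" for y
      using that step[of "y - 1"] less[of "y - 1"] by auto
    have lessn: "rank B (Suc n) < rank A (Suc n)" using less by simp
    have Aw: "rank A (Suc n) \<le> w" using full rank_mono[of "Suc n" "Suc (Suc n)" A] c by simp
    \<comment> \<open>At the top height the upper path runs from
      \<open>rank B (Suc n) < rank A (Suc n)\<close> to \<open>w\<close>, hence passes through the
      entry point of the lower path. This common vertex must be the end point, so only the upper
      path has an east step there.\<close>
    have "rank A (Suc n) = w"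
      using meet[of "Suc n" "rank A (Suc n)"] lessn Aw full c by (auto simp: rank_Suc)
    then have "Suc n \<notin> A" using full c by (auto simp: rank_Suc split: if_splits)
    moreover have "Suc n \<in> B"
      using lessn Aw full c by (auto simp: rank_Suc[of B "Suc n"] split: if_splits)
    moreover have "A \<subseteq> {..n}"
    proof
      fix a assume "a \<in> A"
      then have "a \<le> Suc n" "a \<noteq> Suc n" using assms \<open>Suc n \<notin> A\<close> by auto
      then show "a \<in> {..n}" by simp
    qed
    moreover have "B \<subseteq> {1..Suc n}"
    proof
      fix b assume "b \<in> B"
      then have "b \<in> {..Suc n}" "b \<noteq> 0" using assms \<open>0 \<notin> B\<close> by (blast, metis)
      then show "b \<in> {1..Suc n}" by simp
    qed
    ultimately show "admissible n w A B"
      unfolding admissible_def using c sep by blast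
  next
    assume ad: "admissible n w A B"
    then have sets: "A \<subseteq> {..n}" "0 \<in> A" "B \<subseteq> {1..Suc n}" "Suc n \<in> B" "card A = w" "card B = w"
      and sep: "\<And>y. y \<in> {1..n} \<Longrightarrow> rank B (Suc y) < rank A y"
      by (auto simp: admissible_def)
    have B0: "0 \<notin> B" using sets by auto
    have "A \<subseteq> {..<Suc n}" using sets(1) by (simp add: lessThan_Suc_atMost)
    then have "rank A (Suc n) = w" using sets(5) rank_eq_card by blast
    moreover have "rank B (Suc n) \<le> w" using full sets by (simp add: rank_Suc)
    ultimately show ?b unfolding b using sets B0 full
    proof (intro conjI allI iffI)
      fix x y
      assume *: "y \<le> Suc n \<and> rank B y \<le> x \<and> x \<le> rank B (Suc y) \<and> rank A y \<le> x \<and> x \<le> rank A (Suc y)"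
      \<comment> \<open>A common vertex at an inner height would give
        \<open>x \<le> rank B (Suc y) < rank A y \<le> x\<close>.\<close>
      then have "y \<notin> {1..n}" using sep[of y] by force
      then have "y = 0 \<or> y = Suc n" using * by auto
      then show "(x, y) = (0, 0) \<or> (x, y) = (w, Suc n)"
        using * B0 full sets \<open>rank A (Suc n) = w\<close> by (auto simp: rank_Suc[of _ 0])
    qed auto
  qed
qed

text \<open>The cells by rows instead of columns: between the heights \<open>y\<close> and
  \<open>y + 1\<close> the upper and the lower path run vertically at the abscissas
  \<open>rank B (Suc y)\<close> and \<open>rank A (Suc y)\<close>.\<close>

definition polyomino_of :: "nat set \<Rightarrow> nat set \<Rightarrow> (nat \<times> nat) set" where
  "polyomino_of A B = {(x, y). rank B (Suc y) \<le> x \<and> x < rank A (Suc y)}"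

text \<open>The horizontal edge of a path in column \<open>x\<close> is at the height whose rank is
  \<open>x\<close>. The bound \<open>x < card B\<close> that arises for the upper edge follows from
  \<open>x < rank A (Suc y)\<close>, as both sets have \<open>w\<close> elements.\<close>

lemma cells_between_stair:
  assumes "admissible n w A B"
  shows "cells_between (stair B (Suc n)) (stair A (Suc n)) = polyomino_of A B"
proof -
  have sets: "A \<subseteq> {..n}" "B \<subseteq> {1..Suc n}" "card A = w" "card B = w"
    using assms by (auto simp: admissible_def)
  then have fin: "finite A" "finite B" by (auto intro: finite_subset)
  have edges: "(x, a) \<in> east_edges (stair A (Suc n)) \<longleftrightarrow> a \<in> A \<and> rank A a = x"
    "(x, b) \<in> east_edges (stair B (Suc n)) \<longleftrightarrow> b \<in> B \<and> rank B b = x" for x a b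
    unfolding east_edges_stair using sets by auto
  have "(\<exists>a b. (x, a) \<in> east_edges (stair A (Suc n)) \<and> (x, b) \<in> east_edges (stair B (Suc n)) \<and>
      a \<le> y \<and> y < b) \<longleftrightarrow>
      (\<exists>a\<in>A. a \<le> y \<and> rank A a = x) \<and> (\<exists>b\<in>B. y < b \<and> rank B b = x)" for x y
    unfolding edges by blast
  then show ?thesis
    unfolding cells_between_def polyomino_of_def ex_rank_eq_iff ex_rank_eq_greater_iff[OF fin(2)]
    using rank_le_card[OF fin(1)] sets by (auto intro: less_le_trans)
qed

lemma step_polyomino_iff:
  "step_polyomino w (Suc n) P \<longleftrightarrow> (\<exists>A B. admissible n w A B \<and> P = polyomino_of A B)"
proof
  assume "step_polyomino w (Suc n) P"
  then obtain U L where UL: "bounding_paths w (Suc n) U L" "P = cells_between U L"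
      "no_consecutive_east U" "no_consecutive_east L"
    by (auto simp: step_polyomino_def)
  then have "count_list U North = Suc n" "count_list L North = Suc n"
    by (auto simp: bounding_paths_def path_end_eq)
  then obtain A B where AB: "A \<subseteq> {..Suc n}" "L = stair A (Suc n)" "B \<subseteq> {..Suc n}" "U = stair B (Suc n)"
    using UL(3,4) ex_stair by metis
  then have "admissible n w A B" using UL(1) bounding_paths_stair by blast
  then show "\<exists>A B. admissible n w A B \<and> P = polyomino_of A B"
    using cells_between_stair AB UL(2) by metis
next
  assume "\<exists>A B. admissible n w A B \<and> P = polyomino_of A B"
  then obtain A B where AB: "admissible n w A B" "P = polyomino_of A B" by auto
  then have "A \<subseteq> {..Suc n}" "B \<subseteq> {..Suc n}" by (auto simp: admissible_def)
  then show "step_polyomino w (Suc n) P"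
    unfolding step_polyomino_def
    using AB bounding_paths_stair cells_between_stair no_consecutive_east_stair by metis
qed

text \<open>Every row of the polyomino is nonempty, so the row determines both of its ends.\<close>

lemma admissible_rank_less:
  assumes "admissible n w A B" "y \<le> n"
  shows "rank B (Suc y) < rank A (Suc y)"
proof (cases "y = 0")
  case True
  then show ?thesis using assms by (auto simp: admissible_def rank_Suc)
next
  case False
  then have "rank B (Suc y) < rank A y" using assms by (auto simp: admissible_def)
  then show ?thesis using rank_mono[of y "Suc y" A] by simp
qed

lemma mem_iff_if_rank_eq:
  assumes "\<And>y. y \<le> m \<Longrightarrow> rank A (Suc y) = rank A' (Suc y)" "y \<le> m"
  shows "y \<in> A \<longleftrightarrow> y \<in> A'"
proof -
  have "rank A y = rank A' y" using assms by (cases y) auto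
  then show ?thesis using assms(1)[OF assms(2)] by (auto simp: rank_Suc split: if_splits)
qed

text \<open>The ends of the rows give the ranks, whose jumps give the elements up to
  \<open>n\<close>; above \<open>n\<close>, admissibility leaves only \<open>Suc n\<close>, in
  \<open>B\<close>.\<close>

lemma inj_polyomino_of:
  assumes ad: "admissible n w A B" "admissible n w A' B'"
    and eq: "polyomino_of A B = polyomino_of A' B'"
  shows "A = A' \<and> B = B'"
proof -
  have "rank A (Suc y) = rank A' (Suc y) \<and> rank B (Suc y) = rank B' (Suc y)" if "y \<le> n" for y
  proof -
    have "{rank B (Suc y)..<rank A (Suc y)} = {rank B' (Suc y)..<rank A' (Suc y)}"
      using eq by (auto simp: polyomino_of_def set_eq_iff)
    then show ?thesis
      using admissible_rank_less[OF ad(1) that] admissible_rank_less[OF ad(2) that]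
        atLeastLessThan_inj by metis
  qed
  then have "y \<in> A \<longleftrightarrow> y \<in> A'" "y \<in> B \<longleftrightarrow> y \<in> B'" if "y \<le> n" for y
    using mem_iff_if_rank_eq[of n A A' y] mem_iff_if_rank_eq[of n B B' y] that by auto
  moreover have "y \<in> A \<longleftrightarrow> y \<in> A'" "y \<in> B \<longleftrightarrow> y \<in> B'" if "\<not> y \<le> n" for y
    using that ad by (auto simp: admissible_def subset_iff le_Suc_eq)
  ultimately show ?thesis by blast
qed

section \<open>Diagrams of admissible pairs\<close>

text \<open>
  The diagram whose corners have as rows the nonzero elements of \<open>A\<close>, and as columns the numbers
  \<open>n + 1 - b > 0\<close> with \<open>b \<in> B\<close>: a cell lies in it iff there are fewer corners in the rows above it
  than corners weakly to the right of its column. The element \<open>0\<close> of \<open>A\<close> turns \<open><\<close> into \<open>\<le>\<close>.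
\<close>

definition diagram_of :: "nat \<Rightarrow> nat set \<Rightarrow> nat set \<Rightarrow> (nat \<times> nat) set" where
  "diagram_of n A B = {(i, j). 1 \<le> i \<and> 1 \<le> j \<and> rank A i \<le> rank B (Suc (Suc n - j))}"

context
  fixes n w A B
  assumes ad: "admissible n w A B"
begin

lemma admissible_rank_total: "rank A (Suc (Suc n)) = w" "rank B (Suc (Suc n)) = w"
proof -
  have "A \<subseteq> {..<Suc (Suc n)}" "B \<subseteq> {..<Suc (Suc n)}"
    using ad by (auto simp: admissible_def less_Suc_eq_le)
  then show "rank A (Suc (Suc n)) = w" "rank B (Suc (Suc n)) = w"
    using ad rank_eq_card by (auto simp: admissible_def)
qed

lemma admissible_rank_pos:
  assumes "1 \<le> i"
  shows "1 \<le> rank A i"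
  using rank_strict_mono[of 0 A i] ad assms by (auto simp: admissible_def)

text \<open>Consecutive rows can differ only where \<open>rank A\<close> jumps. Conversely a jump at
  \<open>i\<close> is visible in a column whose threshold is exactly \<open>rank A i\<close>. Thus
  the diagram determines the nonzero elements of \<open>A\<close>, and these are its corner
  rows.\<close>

lemma diagram_of_row_change:
  assumes "1 \<le> i"
  shows "i \<in> A \<longleftrightarrow> (\<exists>j. (i, j) \<in> diagram_of n A B \<and> (Suc i, j) \<notin> diagram_of n A B)"
proof
  assume "i \<in> A"
  let ?c = "rank A i"
  have "i \<le> n" using \<open>i \<in> A\<close> ad by (auto simp: admissible_def)
  then have c: "1 \<le> ?c" "?c < w"
    using admissible_rank_pos[OF assms] rank_strict_mono[OF \<open>i \<in> A\<close>, of "Suc (Suc n)"]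
      admissible_rank_total by auto
  then have "?c - 1 < rank B (Suc (Suc n))" using admissible_rank_total by simp
  then obtain b where b: "b \<in> B" "b < Suc (Suc n)" "rank B b = ?c - 1"
    using ex_rank_eq by blast
  then have "rank B (Suc b) = ?c" using c by (simp add: rank_Suc)
  \<comment> \<open>This makes the column \<open>Suc n - b\<close> positive, hence a genuine
    column.\<close>
  moreover from this have "b \<noteq> Suc n" using c admissible_rank_total by auto
  ultimately have "(i, Suc n - b) \<in> diagram_of n A B" "(Suc i, Suc n - b) \<notin> diagram_of n A B"
    using b assms \<open>i \<in> A\<close> by (auto simp: diagram_of_def rank_Suc)
  then show "\<exists>j. (i, j) \<in> diagram_of n A B \<and> (Suc i, j) \<notin> diagram_of n A B" by blast
next
  assume "\<exists>j. (i, j) \<in> diagram_of n A B \<and> (Suc i, j) \<notin> diagram_of n A B"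
  then show "i \<in> A" by (auto simp: diagram_of_def rank_Suc split: if_splits)
qed

text \<open>The analogue for columns, which recovers \<open>B\<close>: passing from column
  \<open>Suc n - y\<close> to the next one lowers the threshold from \<open>rank B (Suc y)\<close>
  to \<open>rank B y\<close>. A row \<open>a\<close> with \<open>rank A a = rank B (Suc y)\<close>
  detects a drop.\<close>

lemma diagram_of_column_change:
  assumes "y \<in> {1..n}"
  shows "y \<in> B \<longleftrightarrow>
    (\<exists>i. (i, Suc n - y) \<in> diagram_of n A B \<and> (i, Suc (Suc n - y)) \<notin> diagram_of n A B)"
proof -
  have "Suc n - (Suc n - y) = y" "Suc (Suc n - Suc (Suc n - y)) = y" "1 \<le> Suc n - y"
    using assms by auto
  then have mem: "(i, Suc n - y) \<in> diagram_of n A B \<longleftrightarrow> 1 \<le> i \<and> rank A i \<le> rank B (Suc y)"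
    "(i, Suc (Suc n - y)) \<in> diagram_of n A B \<longleftrightarrow> 1 \<le> i \<and> rank A i \<le> rank B y" for i
    unfolding diagram_of_def using assms by simp_all
  show ?thesis
  proof
    assume "y \<in> B"
    let ?c = "rank B (Suc y)"
    have "Suc n \<in> B" using ad by (auto simp: admissible_def)
    then have "?c < w"
      using rank_mono[of "Suc y" "Suc n" B] assms admissible_rank_total
      by (auto simp: rank_Suc[of B "Suc n"])
    then obtain a where a: "a \<in> A" "rank A a = ?c"
      using ex_rank_eq admissible_rank_total by metis
    have "?c = Suc (rank B y)" using \<open>y \<in> B\<close> by (simp add: rank_Suc)
    moreover from this have "1 \<le> a" using a by (cases a) auto
    ultimately show "\<exists>i. (i, Suc n - y) \<in> diagram_of n A B \<and> (i, Suc (Suc n - y)) \<notin> diagram_of n A B"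
      unfolding mem using a by (intro exI[of _ a]) simp
  next
    assume "\<exists>i. (i, Suc n - y) \<in> diagram_of n A B \<and> (i, Suc (Suc n - y)) \<notin> diagram_of n A B"
    then show "y \<in> B" unfolding mem by (auto simp: rank_Suc split: if_splits)
  qed
qed

text \<open>A cell with \<open>Suc n - j \<le> i\<close> would give
  \<open>rank A i \<le> rank B (Suc i)\<close>, contradicting separation if
  \<open>i \<le> n\<close>. For larger \<open>i\<close> all of \<open>A\<close> is counted, but
  \<open>rank B (Suc n)\<close> misses the element \<open>Suc n\<close>.\<close>

lemma diagram_of_staircase:
  assumes "(i, j) \<in> diagram_of n A B"
  shows "1 \<le> i \<and> 1 \<le> j \<and> i + j \<le> n"
proof -
  have ij: "1 \<le> i" "1 \<le> j" "rank A i \<le> rank B (Suc (Suc n - j))"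
    using assms by (auto simp: diagram_of_def)
  have "i < Suc n - j"
  proof (rule ccontr)
    assume "\<not> ?thesis"
    show False
    proof (cases "i \<le> n")
      case True
      then have "rank B (Suc i) < rank A i" using ad ij by (auto simp: admissible_def)
      then show False
        using ij \<open>\<not> i < Suc n - j\<close> rank_mono[of "Suc (Suc n - j)" "Suc i" B] by auto
    next
      case False
      have "A \<subseteq> {..<i}" using ad False by (auto simp: admissible_def)
      then have "rank A i = w" using rank_eq_card ad by (auto simp: admissible_def)
      moreover have "rank B (Suc n) < w"
        using admissible_rank_total ad by (auto simp: rank_Suc admissible_def)
      moreover have "rank B (Suc (Suc n - j)) \<le> rank B (Suc n)"
        using ij by (intro rank_mono) linarith
      ultimately show False using ij by linarith
    qed
  qed
  then show ?thesis using ij by auto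
qed

end

lemma diagram_of_down_closed:
  assumes "(i, j) \<in> diagram_of n A B" "1 \<le> i'" "i' \<le> i" "1 \<le> j'" "j' \<le> j"
  shows "(i', j') \<in> diagram_of n A B"
proof -
  have "rank A i' \<le> rank A i" using assms by (intro rank_mono)
  also have "\<dots> \<le> rank B (Suc (Suc n - j))" using assms by (auto simp: diagram_of_def)
  also have "\<dots> \<le> rank B (Suc (Suc n - j'))" using assms by (intro rank_mono) linarith
  finally show ?thesis using assms by (simp add: diagram_of_def)
qed

lemma inj_diagram_of:
  assumes ad: "admissible n w A B" "admissible n w A' B'"
    and eq: "diagram_of n A B = diagram_of n A' B'"
  shows "A = A' \<and> B = B'"
proof -
  have "i \<in> A \<longleftrightarrow> i \<in> A'" for i
  proof (cases "i = 0")
    case True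
    then show ?thesis using ad by (auto simp: admissible_def)
  next
    case False
    then show ?thesis
      using diagram_of_row_change[OF ad(1)] diagram_of_row_change[OF ad(2)] eq by simp
  qed
  moreover have "y \<in> B \<longleftrightarrow> y \<in> B'" for y
  proof (cases "y \<in> {1..n}")
    case True
    then show ?thesis
      using diagram_of_column_change[OF ad(1)] diagram_of_column_change[OF ad(2)] eq by simp
  next
    case False
    then show ?thesis using ad by (auto simp: admissible_def subset_iff le_Suc_eq)
  qed
  ultimately show ?thesis by blast
qed

section \<open>Partitions, their diagrams and their corners\<close>

lemma partition_part_antimono:
  assumes "int_partition \<Lambda>" "1 \<le> i" "i \<le> i'"
  shows "partition_part \<Lambda> i' \<le> partition_part \<Lambda> i"
proof (cases "i' = i")
  case False
  then show ?thesis
    using assms by (auto simp: int_partition_def partition_part_def sorted_wrt_iff_nth_less)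
qed simp

lemma young_diagram_mem_iff:
  "(i, j) \<in> young_diagram \<Lambda> \<longleftrightarrow> 1 \<le> i \<and> 1 \<le> j \<and> j \<le> partition_part \<Lambda> i"
  by (simp add: young_diagram_def)

lemma ex_partition_part_eq:
  fixes r :: "nat \<Rightarrow> nat"
  assumes anti: "\<And>i i'. \<lbrakk>1 \<le> i; i \<le> i'\<rbrakk> \<Longrightarrow> r i' \<le> r i" and zero: "r (Suc n) = 0"
  shows "\<exists>\<Lambda>. int_partition \<Lambda> \<and> (\<forall>i\<ge>1. partition_part \<Lambda> i = r i)"
proof -
  \<comment> \<open>The number of nonzero parts; the trailing zeros of \<open>r\<close> are cut off
    because a partition lists only nonzero parts.\<close>
  define m where "m = (LEAST m. r (Suc m) = 0)"
  have m0: "r (Suc m) = 0" unfolding m_def using zero by (rule LeastI)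
  have pos: "0 < r (Suc k)" if "k < m" for k
    using not_less_Least[OF that[unfolded m_def]] by simp
  have zero': "r i = 0" if "m < i" for i using anti[of "Suc m" i] m0 that by simp
  have "int_partition (map (\<lambda>k. r (Suc k)) [0..<m])"
    using anti pos by (auto simp: int_partition_def sorted_wrt_iff_nth_less)
  moreover have "\<forall>i\<ge>1. partition_part (map (\<lambda>k. r (Suc k)) [0..<m]) i = r i"
    using zero' by (auto simp: partition_part_def)
  ultimately show ?thesis by blast
qed

text \<open>Closure to the left makes each row an initial segment, closure upwards makes the row
  lengths decrease, and the staircase bound leaves row \<open>Suc n\<close> empty.\<close>

lemma ex_young_diagram:
  assumes bd: "\<And>i j. (i, j) \<in> D \<Longrightarrow> 1 \<le> i \<and> 1 \<le> j \<and> i + j \<le> n"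
    and down: "\<And>i j i' j'. \<lbrakk>(i, j) \<in> D; 1 \<le> i'; i' \<le> i; 1 \<le> j'; j' \<le> j\<rbrakk> \<Longrightarrow> (i', j') \<in> D"
  shows "\<exists>\<Lambda>. int_partition \<Lambda> \<and> young_diagram \<Lambda> = D"
proof -
  define r where "r i = card {j. (i, j) \<in> D}" for i
  have fin: "finite {j. (i, j) \<in> D}" for i
    by (rule finite_subset[of _ "{..n}"]) (use bd in force)+
  have row: "(i, j) \<in> D \<longleftrightarrow> 1 \<le> j \<and> j \<le> r i" for i j
  proof
    assume "(i, j) \<in> D"
    then have "{1..j} \<subseteq> {j. (i, j) \<in> D}"
      using down[OF \<open>(i, j) \<in> D\<close>, of i] bd[OF \<open>(i, j) \<in> D\<close>] by auto
    then have "card {1..j} \<le> r i" unfolding r_def using fin card_mono by blast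
    then show "1 \<le> j \<and> j \<le> r i" using bd \<open>(i, j) \<in> D\<close> by auto
  next
    assume *: "1 \<le> j \<and> j \<le> r i"
    show "(i, j) \<in> D"
    proof (rule ccontr)
      assume "(i, j) \<notin> D"
      have "k < j" if "(i, k) \<in> D" for k
        using down[OF that, of i j] bd[OF that] * \<open>(i, j) \<notin> D\<close> by (cases "k < j") auto
      then have "{j. (i, j) \<in> D} \<subseteq> {1..<j}" using bd by auto
      then have "r i \<le> card {1..<j}" unfolding r_def by (intro card_mono) auto
      then show False using * by auto
    qed
  qed
  have anti: "r i' \<le> r i" if "1 \<le> i" "i \<le> i'" for i i'
  proof -
    have "{j. (i', j) \<in> D} \<subseteq> {j. (i, j) \<in> D}"
      using down[of i' _ i] bd[of i'] that by blast
    then show ?thesis unfolding r_def using fin by (intro card_mono)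
  qed
  have "(Suc n, r (Suc n)) \<notin> D" using bd by fastforce
  then have "r (Suc n) = 0" using row[of "Suc n" "r (Suc n)"] by simp
  then obtain \<Lambda> where \<Lambda>: "int_partition \<Lambda>" "\<forall>i\<ge>1. partition_part \<Lambda> i = r i"
    using ex_partition_part_eq[of r n] anti by blast
  then have "young_diagram \<Lambda> = D"
    using bd row by (auto simp: young_diagram_mem_iff)
  then show ?thesis using \<Lambda> by blast
qed

lemma fits_in_staircase_iff:
  "fits_in_staircase n \<Lambda> \<longleftrightarrow> (\<forall>(i, j) \<in> young_diagram \<Lambda>. i + j \<le> n)"
proof
  assume "fits_in_staircase n \<Lambda>"
  then show "\<forall>(i, j) \<in> young_diagram \<Lambda>. i + j \<le> n"
    by (force simp: fits_in_staircase_def young_diagram_mem_iff)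
next
  assume *: "\<forall>(i, j) \<in> young_diagram \<Lambda>. i + j \<le> n"
  show "fits_in_staircase n \<Lambda>"
    unfolding fits_in_staircase_def
  proof (intro allI impI)
    fix i :: nat assume "1 \<le> i"
    then show "partition_part \<Lambda> i \<le> n - i"
      using *[rule_format, of "(i, partition_part \<Lambda> i)"]
      by (cases "partition_part \<Lambda> i = 0") (auto simp: young_diagram_mem_iff)
  qed
qed

lemma card_diagram_corners:
  "card (diagram_corners \<Lambda>) = card {i. 1 \<le> i \<and> partition_part \<Lambda> (Suc i) < partition_part \<Lambda> i}"
proof -
  have "diagram_corners \<Lambda> = (\<lambda>i. (i, partition_part \<Lambda> i)) `
      {i. 1 \<le> i \<and> partition_part \<Lambda> (Suc i) < partition_part \<Lambda> i}"
    by (auto simp: diagram_corners_def)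
  then show ?thesis by (simp add: card_image inj_on_def)
qed

text \<open>Expresses corner rows through the set of cells alone, for comparison with
  \<open>diagram_of_row_change\<close>.\<close>

lemma young_diagram_row_change:
  assumes "1 \<le> i"
  shows "(\<exists>j. (i, j) \<in> young_diagram \<Lambda> \<and> (Suc i, j) \<notin> young_diagram \<Lambda>) \<longleftrightarrow>
    partition_part \<Lambda> (Suc i) < partition_part \<Lambda> i"
proof
  assume "partition_part \<Lambda> (Suc i) < partition_part \<Lambda> i"
  then show "\<exists>j. (i, j) \<in> young_diagram \<Lambda> \<and> (Suc i, j) \<notin> young_diagram \<Lambda>"
    using assms by (intro exI[of _ "partition_part \<Lambda> i"]) (auto simp: young_diagram_mem_iff)
qed (auto simp: young_diagram_mem_iff)

lemma diagram_of_is_young_diagram: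
  assumes ad: "admissible n w A B"
  shows "\<exists>\<Lambda>. diagram_of n A B = young_diagram \<Lambda> \<and> int_partition \<Lambda> \<and> fits_in_staircase n \<Lambda> \<and>
    card (diagram_corners \<Lambda>) = w - 1"
proof -
  obtain \<Lambda> where \<Lambda>: "int_partition \<Lambda>" "young_diagram \<Lambda> = diagram_of n A B"
    using ex_young_diagram[of "diagram_of n A B" n] diagram_of_staircase[OF ad]
      diagram_of_down_closed by blast
  have "fits_in_staircase n \<Lambda>"
    using diagram_of_staircase[OF ad] \<Lambda>(2) by (auto simp: fits_in_staircase_iff)
  moreover have "{i. 1 \<le> i \<and> partition_part \<Lambda> (Suc i) < partition_part \<Lambda> i} = A - {0}"
    using diagram_of_row_change[OF ad] young_diagram_row_change[of _ \<Lambda>] \<Lambda>(2) by fastforce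
  moreover have "card (A - {0}) = w - 1" using ad by (auto simp: admissible_def)
  ultimately show ?thesis using \<Lambda> card_diagram_corners by metis
qed

text \<open>The last row of a block of equal rows carries a corner. The final block ends at
  \<open>length \<Lambda>\<close>, since the part after it is 0 by convention.\<close>

lemma ex_last_equal_part:
  assumes "int_partition \<Lambda>" "1 \<le> i" "0 < partition_part \<Lambda> i"
  shows "\<exists>t\<ge>i. partition_part \<Lambda> (Suc t) < partition_part \<Lambda> t \<and> partition_part \<Lambda> t = partition_part \<Lambda> i"
proof -
  have "i \<le> length \<Lambda>" using assms(3) by (auto simp: partition_part_def split: if_splits)
  then show ?thesis using assms(2,3)
  proof (induction i rule: inc_induct)
    case base
    then show ?case by (intro exI[of _ "length \<Lambda>"]) (auto simp: partition_part_def)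
  next
    case (step k)
    show ?case
    proof (cases "partition_part \<Lambda> (Suc k) < partition_part \<Lambda> k")
      case False
      then have "partition_part \<Lambda> (Suc k) = partition_part \<Lambda> k"
        using partition_part_antimono[OF assms(1), of k "Suc k"] step.prems by simp
      then show ?thesis using step.IH step.prems by (metis Suc_leD le_SucI)
    qed auto
  qed
qed

lemma young_diagram_is_diagram_of:
  assumes part: "int_partition \<Lambda>" and fits: "fits_in_staircase n \<Lambda>"
    and corners: "card (diagram_corners \<Lambda>) = w - 1" and "1 \<le> w"
  shows "\<exists>A B. admissible n w A B \<and> diagram_of n A B = young_diagram \<Lambda>"
proof -
  define l where "l = partition_part \<Lambda>"
  define T where "T = {i. 1 \<le> i \<and> l (Suc i) < l i}"
  define A where "A = insert 0 T"
  define B where "B = insert (Suc n) ((\<lambda>t. Suc n - l t) ` T)"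
  have l_le: "l i \<le> n - i" if "1 \<le> i" for i
    using fits that by (auto simp: fits_in_staircase_def l_def)
  have T: "1 \<le> t \<and> t \<le> n \<and> 0 < l t \<and> l t \<le> n" if "t \<in> T" for t
    using that l_le[of t] by (auto simp: T_def)
  have anti: "l t' \<le> l t" if "1 \<le> t" "t \<le> t'" for t t'
    using partition_part_antimono[OF part that] by (simp add: l_def)
  have strict: "l t' < l t" if "t \<in> T" "t < t'" for t t'
    using that anti[of "Suc t" t'] by (auto simp: T_def)
  have finT: "finite T" using T by (intro finite_subset[of T "{..n}"]) auto
  \<comment> \<open>Row lengths drop strictly after a corner, so distinct corners lie in distinct
    columns and \<open>B\<close> gets \<open>w\<close> elements.\<close>
  have inj: "inj_on (\<lambda>t. Suc n - l t) T"
  proof (rule inj_onI)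
    fix t t' assume *: "t \<in> T" "t' \<in> T" "Suc n - l t = Suc n - l t'"
    then have "l t = l t'" using T[of t] T[of t'] by linarith
    then show "t = t'" using strict[of t t'] strict[of t' t] * by (cases t t' rule: linorder_cases) auto
  qed
  have cardT: "card T = w - 1"
    using corners card_diagram_corners[of \<Lambda>] by (simp add: T_def l_def)
  have "0 \<notin> T" "Suc n \<notin> (\<lambda>t. Suc n - l t) ` T" using T by force+
  then have cards: "card A = w" "card B = w"
    using cardT finT \<open>1 \<le> w\<close> card_image[OF inj] by (auto simp: A_def B_def)
  \<comment> \<open>Up to the element \<open>0\<close> of \<open>A\<close>, this compares the number
    of corners above row \<open>i\<close> with the number of corners in columns from
    \<open>j\<close> on. If \<open>j \<le> l i\<close>, the latter include all the former and the
    corner ending the block of row \<open>i\<close>; otherwise they all lie above row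
    \<open>i\<close>.\<close>
  have key: "rank A i \<le> rank B (Suc (Suc n - j)) \<longleftrightarrow> j \<le> l i" if "1 \<le> i" "1 \<le> j" for i j
  proof -
    have "A \<inter> {..<i} = insert 0 (T \<inter> {..<i})" using that by (auto simp: A_def)
    then have A: "rank A i = Suc (card (T \<inter> {..<i}))"
      using \<open>0 \<notin> T\<close> finT by (simp add: rank_def)
    let ?S = "{t \<in> T. j \<le> l t}"
    have iff: "Suc n - l t < Suc (Suc n - j) \<longleftrightarrow> j \<le> l t" if "t \<in> T" for t
      using T[OF that] by linarith
    have "B \<inter> {..<Suc (Suc n - j)} = (\<lambda>t. Suc n - l t) ` ?S"
      using iff \<open>1 \<le> j\<close> unfolding B_def by fastforce
    then have B: "rank B (Suc (Suc n - j)) = card ?S"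
      using card_image[OF inj_on_subset[OF inj, of ?S]] by (auto simp: rank_def)
    show ?thesis
    proof
      assume "j \<le> l i"
      then have "0 < partition_part \<Lambda> i" using that by (simp add: l_def)
      then obtain t where t: "t \<ge> i" "l (Suc t) < l t" "l t = l i"
        using ex_last_equal_part[OF part \<open>1 \<le> i\<close>] unfolding l_def by blast
      then have "t \<in> T" using \<open>1 \<le> i\<close> by (simp add: T_def)
      have "insert t (T \<inter> {..<i}) \<subseteq> ?S"
        using t \<open>t \<in> T\<close> \<open>j \<le> l i\<close> strict[of _ i] by force
      then have "card (insert t (T \<inter> {..<i})) \<le> card ?S" using finT by (intro card_mono) auto
      then show "rank A i \<le> rank B (Suc (Suc n - j))" using A B t finT by simp
    next
      assume le: "rank A i \<le> rank B (Suc (Suc n - j))"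
      show "j \<le> l i"
      proof (rule ccontr)
        assume "\<not> j \<le> l i"
        then have "t < i" if "t \<in> ?S" for t
          using anti[OF \<open>1 \<le> i\<close>, of t] that by (cases "t < i") auto
        then have "?S \<subseteq> T \<inter> {..<i}" by auto
        then have "card ?S \<le> card (T \<inter> {..<i})" using finT by (intro card_mono) auto
        then show False using le A B by simp
      qed
    qed
  qed
  have "rank B (Suc y) < rank A y" if "y \<in> {1..n}" for y
  proof -
    \<comment> \<open>The cell \<open>(y, Suc n - y)\<close> lies just outside the staircase;
      \<open>key\<close> for this cell is the separation condition.\<close>
    have "\<not> Suc n - y \<le> l y" using that l_le[of y] by auto
    moreover have "Suc n - (Suc n - y) = y" using that by auto
    ultimately show ?thesis using key[of y "Suc n - y"] that by auto
  qed
  moreover have "A \<subseteq> {..n}" "B \<subseteq> {1..Suc n}" using T by (force simp: A_def B_def)+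
  ultimately have "admissible n w A B"
    using cards by (auto simp: admissible_def A_def B_def)
  moreover have "diagram_of n A B = young_diagram \<Lambda>"
    using key by (auto simp: diagram_of_def young_diagram_def l_def)
  ultimately show ?thesis by blast
qed

section \<open>Composition of the two encodings by admissible pairs\<close>

theorem theorem3p4:
  fixes n w :: nat
  assumes "n \<ge> 1" and "w \<ge> 1"
  shows "\<exists>f. bij_betw f
           {P. step_polyomino w (n + 1) P}
           {young_diagram \<Lambda> | \<Lambda>. int_partition \<Lambda> \<and> fits_in_staircase n \<Lambda> \<and>
              card (diagram_corners \<Lambda>) = w - 1}"
    (is "\<exists>f. bij_betw f ?P ?Y")
proof -
  let ?Z = "{(A, B). admissible n w A B}"
  have "(\<lambda>(A, B). polyomino_of A B) ` ?Z = ?P"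
    by (auto simp: step_polyomino_iff)
  moreover have "inj_on (\<lambda>(A, B). polyomino_of A B) ?Z"
    using inj_polyomino_of by (auto simp: inj_on_def)
  ultimately have P: "bij_betw (\<lambda>(A, B). polyomino_of A B) ?Z ?P"
    by (simp add: bij_betw_def)
  have "(\<lambda>(A, B). diagram_of n A B) ` ?Z = ?Y"
  proof
    show "(\<lambda>(A, B). diagram_of n A B) ` ?Z \<subseteq> ?Y"
      using diagram_of_is_young_diagram by auto
    show "?Y \<subseteq> (\<lambda>(A, B). diagram_of n A B) ` ?Z"
      using young_diagram_is_diagram_of \<open>w \<ge> 1\<close> by (fastforce simp: image_iff)
  qed
  moreover have "inj_on (\<lambda>(A, B). diagram_of n A B) ?Z"
    using inj_diagram_of by (auto simp: inj_on_def)
  ultimately have "bij_betw (\<lambda>(A, B). diagram_of n A B) ?Z ?Y"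
    by (simp add: bij_betw_def)
  then show ?thesis using bij_betw_trans[OF bij_betw_inv_into[OF P]] by blast
qed

end
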